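(* Let $G_1$ be an $r_1$-regular graph with $n_1$ vertices and let $G_2$ be an $r_2$-regular graph with $n_2$ vertices. Then the normalized Laplacian spectrum (with multiplicities) of $G_1\veebar G_2$ consists of: - $1+\dfrac{r_2(\delta_i(G_2)-1)}{n_1+r_2}$ for $i=2,3,\dots,n_2$; - $1+\dfrac{(\delta_i(G_1)-1)\left(\sqrt{9r_1^2+4r_1n_2}+r_1\right)}{2(2r_1+n_2)}$ for $i=2,3,\dots,n_1$; - $1+\dfrac{(1-\delta_i(G_1))\left(\sqrt{9r_1^2+4r_1n_2}-r_1\right)}{2(2r_1+n_2)}$ for $i=2,3,\dots,n_1$; - the three roots of the equation $$(2r_1r_2+2r_1n_1+n_2r_2+n_1n_2)x^3-(3r_1r_2+5r_1n_1+2r_2n_2+3n_1n_2)x^2+(3r_1n_1+n_2r_2+2n_1n_2)x=0.$$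
   Context: Graphs are undirected and simple. With $A(G)$ the adjacency matrix and $D(G)$ the diagonal degree matrix of a graph $G$ on $n$ vertices, the normalized Laplacian is $\mathcal L(G)=I_n-D(G)^{-1/2}A(G)D(G)^{-1/2}$, with the convention that for a vertex of degree $0$ one sets $d_i^{-1/2}=0$; entrywise, $\mathcal L(G)_{ij}$ is $1$ if $i=j$ and $d_i\neq 0$, is $-1/\sqrt{d_id_j}$ if $i\ne j$ and the $i$-th and $j$-th vertices are adjacent, and is $0$ otherwise. The normalized Laplacian spectrum is the multiset of eigenvalues of $\mathcal L(G)$, and $0=\delta_1(G)\le\delta_2(G)\le\dots\le\delta_n(G)$ denote these eigenvalues. For vertex-disjoint graphs $G_1$ (with $V(G_1)=\{u_1,\dots,u_{n_1}\}$) and $G_2$, the join $G_1\vee G_2$ is the disjoint union together with all edges between $V(G_1)$ and $V(G_2)$. The NS (Neighbors Splitting) join $G_1\veebar G_2$ is obtained from $G_1\vee G_2$ by adding new vertices $u_1',\dots,u_{n_1}'$ and joining $u_i'$ to $u_j$ if and only if $u_iu_j\in E(G_1)$.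
   Formalization: Both graphs are assumed non-empty and r_1 ≥ 1: for r_1 = 0 the new vertices are isolated and, with the entrywise Laplacian (0 on the diagonal at isolated vertices), the claim fails, e.g. G_1 = G_2 = K_1 has spectrum 0, 0, 2 while the cubic has roots 0, 1, 2. *)

theory Defs
  imports "Graph_Theory.Pair_Digraph" "Jordan_Normal_Form.Char_Poly"
begin

text \<open>
  A finite simple undirected graph is a \<open>pair_graph\<close> (a finite, loop-free, symmetric digraph
  without parallel arcs): an edge uv is represented by the two arcs \<open>(u, v)\<close> and \<open>(v, u)\<close>.
  Hence the degree of a vertex is its out-degree.
\<close>

definition vdeg :: "'a pair_pre_digraph \<Rightarrow> 'a \<Rightarrow> nat" where
  "vdeg G v = out_degree (with_proj G) v"

definition regular_graph :: "nat \<Rightarrow> 'a pair_pre_digraph \<Rightarrow> bool" where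
  "regular_graph r G \<longleftrightarrow> pair_graph G \<and> (\<forall>v \<in> pverts G. vdeg G v = r)"


text \<open>
  Matrices of a graph are taken with respect to an arbitrarily chosen enumeration of the vertices;
  another enumeration conjugates them by a permutation matrix, so the spectrum does not depend
  on the choice.
\<close>

definition vertex_list :: "'a pair_pre_digraph \<Rightarrow> 'a list" where
  "vertex_list G = (SOME vs. distinct vs \<and> set vs = pverts G)"

text \<open>
  The diagonal entry at an isolated vertex is 0, not 1; so 0 is an eigenvalue of every nonempty
  graph, edgeless ones included.
\<close>

definition normalized_laplacian :: "'a pair_pre_digraph \<Rightarrow> real mat" where
  "normalized_laplacian G =
     (let vs = vertex_list G; n = card (pverts G) in
      mat n n (\<lambda>(i, j).
        if i = j \<and> vdeg G (vs ! i) \<noteq> 0 then 1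
        else if i \<noteq> j \<and> (vs ! i, vs ! j) \<in> parcs G
          then - 1 / sqrt (real (vdeg G (vs ! i)) * real (vdeg G (vs ! j)))
        else 0))"

text \<open>
  \<open>proots\<close> counts every eigenvalue with its algebraic multiplicity. The normalized Laplacian of
  a graph is real symmetric, so its characteristic polynomial splits over the reals.
\<close>

definition normalized_laplacian_spectrum :: "'a pair_pre_digraph \<Rightarrow> real multiset" where
  "normalized_laplacian_spectrum G = proots (char_poly (normalized_laplacian G))"

text \<open>The \<open>i\<close>-th smallest eigenvalue, counted with multiplicity and starting from \<open>i = 1\<close>.\<close>

definition nl_eigenvalue :: "'a pair_pre_digraph \<Rightarrow> nat \<Rightarrow> real" where
  "nl_eigenvalue G i = sorted_list_of_multiset (normalized_laplacian_spectrum G) ! (i - 1)"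


text \<open>The sum type makes the two vertex sets disjoint.\<close>

definition graph_join :: "'a pair_pre_digraph \<Rightarrow> 'b pair_pre_digraph \<Rightarrow> ('a + 'b) pair_pre_digraph"
  where
  "graph_join G1 G2 =
     \<lparr> pverts = Inl ` pverts G1 \<union> Inr ` pverts G2,
       parcs = {(Inl u, Inl v) | u v. (u, v) \<in> parcs G1}
             \<union> {(Inr u, Inr v) | u v. (u, v) \<in> parcs G2}
             \<union> {(Inl u, Inr v) | u v. u \<in> pverts G1 \<and> v \<in> pverts G2}
             \<union> {(Inr v, Inl u) | u v. u \<in> pverts G1 \<and> v \<in> pverts G2} \<rparr>"

text \<open>
  \<open>Inl x\<close> is the vertex \<open>x\<close> of the join and \<open>Inr u\<close> is the new vertex u' that is added
  for the vertex \<open>u\<close> of the first graph.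
\<close>

definition ns_join ::
  "'a pair_pre_digraph \<Rightarrow> 'b pair_pre_digraph \<Rightarrow> (('a + 'b) + 'a) pair_pre_digraph" where
  "ns_join G1 G2 =
     \<lparr> pverts = Inl ` pverts (graph_join G1 G2) \<union> Inr ` pverts G1,
       parcs = {(Inl x, Inl y) | x y. (x, y) \<in> parcs (graph_join G1 G2)}
             \<union> {(Inr u, Inl (Inl v)) | u v. (u, v) \<in> parcs G1}
             \<union> {(Inl (Inl v), Inr u) | u v. (u, v) \<in> parcs G1} \<rparr>"

end

theory Submission
  imports Defs
begin

text \<open>
  Since the normalized Laplacian is $I - D^{-1/2}AD^{-1/2}$, it suffices to find the spectrum of the
  similar matrix $D^{-1}A$. On the vertices of $G_1$, of $G_2$ and on the new vertices, replace the
  standard basis by the all-ones vector together with a basis of the vectors of sum zero. As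
  $G_1$ and $G_2$ are regular, $D^{-1}A$ splits into a 3-by-3 block on the all-ones vectors (the
  cubic), a multiple of $A(G_2)$ on sum-zero vectors, and the Kronecker product of a
  2-by-2 matrix with $A(G_1)$ on sum-zero vectors; diagonalizing the 2-by-2 matrix gives the two
  families with square roots. The spectrum of $A(G_i)$ on sum-zero vectors is that of $A(G_i)$ with
  one copy of $r_i$ removed, which corresponds to removing $\delta_1 = 0$: all eigenvalues
  of $A(G_i)$ are real and at most $r_i$.
\<close>

section \<open>Characteristic polynomials of matrices indexed by finite sets\<close>

definition list_mat :: "'a list \<Rightarrow> ('a \<Rightarrow> 'a \<Rightarrow> 'k) \<Rightarrow> 'k mat" where
  "list_mat xs f = mat (length xs) (length xs) (\<lambda>(i, j). f (xs ! i) (xs ! j))"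

definition set_char_poly :: "'a set \<Rightarrow> ('a \<Rightarrow> 'a \<Rightarrow> 'k :: field) \<Rightarrow> 'k poly" where
  "set_char_poly V f = char_poly (list_mat (SOME xs. distinct xs \<and> set xs = V) f)"

lemma list_mat_carrier [simp]: "list_mat xs f \<in> carrier_mat (length xs) (length xs)"
  by (simp add: list_mat_def)

lemma list_mat_dim [simp]: "dim_row (list_mat xs f) = length xs" "dim_col (list_mat xs f) = length xs"
  by (simp_all add: list_mat_def)

lemma sum_distinct_list:
  assumes "distinct xs"
  shows "(\<Sum>x\<in>set xs. h x) = (\<Sum>i<length xs. h (xs ! i))"
  by (rule sum.reindex_bij_betw[symmetric, OF bij_betw_nth[OF assms]]) auto

lemma char_poly_list_mat_similar:
  fixes f :: "'a \<Rightarrow> 'a \<Rightarrow> 'k :: field" and g :: "'b \<Rightarrow> 'b \<Rightarrow> 'k"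
  assumes "distinct xs" "distinct ys" "length xs = length ys"
    and "\<And>u w. u \<in> set xs \<Longrightarrow> w \<in> set ys \<Longrightarrow>
      (\<Sum>v\<in>set xs. f u v * S v w) = (\<Sum>v\<in>set ys. S u v * g v w)"
    and "\<And>u w. u \<in> set ys \<Longrightarrow> w \<in> set ys \<Longrightarrow>
      (\<Sum>v\<in>set xs. T u v * S v w) = (if u = w then 1 else 0)"
  shows "char_poly (list_mat xs f) = char_poly (list_mat ys g)"
proof (rule char_poly_similar)
  let ?n = "length ys"
  define P where "P = mat ?n ?n (\<lambda>(i, j). S (xs ! i) (ys ! j))"
  define Q where "Q = mat ?n ?n (\<lambda>(i, j). T (ys ! i) (xs ! j))"
  let ?F = "list_mat xs f" and ?G = "list_mat ys g"
  have carr: "P \<in> carrier_mat ?n ?n" "Q \<in> carrier_mat ?n ?n"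
    "?F \<in> carrier_mat ?n ?n" "?G \<in> carrier_mat ?n ?n"
    using assms(3) by (auto simp: P_def Q_def list_mat_def)
  have QP: "Q * P = 1\<^sub>m ?n"
  proof (rule eq_matI)
    fix i j assume ij: "i < dim_row (1\<^sub>m ?n)" "j < dim_col (1\<^sub>m ?n)"
    then have "(Q * P) $$ (i, j) = (\<Sum>k<?n. T (ys ! i) (xs ! k) * S (xs ! k) (ys ! j))"
      by (simp add: P_def Q_def scalar_prod_def atLeast0LessThan)
    also have "\<dots> = (\<Sum>v\<in>set xs. T (ys ! i) v * S v (ys ! j))"
      by (simp add: sum_distinct_list[OF assms(1)] assms(3))
    also have "\<dots> = 1\<^sub>m ?n $$ (i, j)"
      using ij assms(2) by (simp add: assms(5) nth_eq_iff_index_eq)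
    finally show "(Q * P) $$ (i, j) = 1\<^sub>m ?n $$ (i, j)" .
  qed (use carr in auto)
  have PQ: "P * Q = 1\<^sub>m ?n"
    by (rule mat_mult_left_right_inverse[OF carr(2,1) QP])
  have FP: "?F * P = P * ?G"
  proof (rule eq_matI)
    fix i j assume "i < dim_row (P * ?G)" "j < dim_col (P * ?G)"
    then have ij: "i < ?n" "j < ?n" using carr by auto
    have "(?F * P) $$ (i, j) = (\<Sum>k<?n. f (xs ! i) (xs ! k) * S (xs ! k) (ys ! j))"
      using ij assms(3) by (simp add: P_def list_mat_def scalar_prod_def atLeast0LessThan)
    also have "\<dots> = (\<Sum>v\<in>set xs. f (xs ! i) v * S v (ys ! j))"
      by (simp add: sum_distinct_list[OF assms(1)] assms(3))
    also have "\<dots> = (\<Sum>v\<in>set ys. S (xs ! i) v * g v (ys ! j))"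
      using ij assms(3) by (simp add: assms(4))
    also have "\<dots> = (\<Sum>k<?n. S (xs ! i) (ys ! k) * g (ys ! k) (ys ! j))"
      by (simp add: sum_distinct_list[OF assms(2)])
    also have "\<dots> = (P * ?G) $$ (i, j)"
      using ij by (simp add: P_def list_mat_def scalar_prod_def atLeast0LessThan)
    finally show "(?F * P) $$ (i, j) = (P * ?G) $$ (i, j)" .
  qed (use carr in auto)
  have "?F = ?F * (P * Q)" by (simp add: PQ right_mult_one_mat[OF carr(3)])
  also have "\<dots> = P * ?G * Q"
    by (simp only: assoc_mult_mat[OF carr(3,1,2), symmetric] FP)
  finally have F: "?F = P * ?G * Q" .
  have "{?F, ?G, P, Q} \<subseteq> carrier_mat ?n ?n"
    using carr by blast
  then show "similar_mat ?F ?G"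
    by (rule similar_matI[OF _ PQ QP F])
qed

lemma sum_mult_delta [simp]:
  fixes h :: "'a \<Rightarrow> 'b :: semiring_1"
  assumes "finite V"
  shows "(\<Sum>v\<in>V. h v * (if v = w then 1 else 0)) = (if w \<in> V then h w else 0)"
    and "(\<Sum>v\<in>V. h v * (if w = v then 1 else 0)) = (if w \<in> V then h w else 0)"
    and "(\<Sum>v\<in>V. (if v = w then 1 else 0) * h v) = (if w \<in> V then h w else 0)"
    and "(\<Sum>v\<in>V. (if w = v then 1 else 0) * h v) = (if w \<in> V then h w else 0)"
  using assms by (simp_all add: if_distrib[of "\<lambda>x. x * _"] if_distrib[of "\<lambda>x. _ * x"] cong: if_cong)

lemma char_poly_list_mat:
  assumes "distinct xs"
  shows "char_poly (list_mat xs f) = set_char_poly (set xs) f"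
proof -
  define ys where "ys = (SOME ys. distinct ys \<and> set ys = set xs)"
  have ys: "distinct ys \<and> set ys = set xs"
    unfolding ys_def by (rule someI[of _ xs]) (use assms in auto)
  have len: "length xs = length ys"
    using assms ys by (metis distinct_card)
  have "char_poly (list_mat xs f) = char_poly (list_mat ys f)"
    by (rule char_poly_list_mat_similar[where S = "\<lambda>u v. if u = v then 1 else 0"
          and T = "\<lambda>u v. if u = v then 1 else 0"])
      (use assms ys len in auto)
  then show ?thesis by (simp add: set_char_poly_def ys_def)
qed

lemma set_char_poly_similar:
  fixes f :: "'a \<Rightarrow> 'a \<Rightarrow> 'k :: field" and g :: "'b \<Rightarrow> 'b \<Rightarrow> 'k"
  assumes "finite V" "finite W" "card V = card W"
    and "\<And>u w. u \<in> V \<Longrightarrow> w \<in> W \<Longrightarrow> (\<Sum>v\<in>V. f u v * S v w) = (\<Sum>v\<in>W. S u v * g v w)"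
    and "\<And>u w. u \<in> W \<Longrightarrow> w \<in> W \<Longrightarrow> (\<Sum>v\<in>V. T u v * S v w) = (if u = w then 1 else 0)"
  shows "set_char_poly V f = set_char_poly W g"
proof -
  obtain xs ys where xy: "distinct xs" "set xs = V" "distinct ys" "set ys = W"
    using assms(1,2) finite_distinct_list by meson
  moreover have "length xs = length ys"
    using xy assms(3) by (metis distinct_card)
  ultimately have "char_poly (list_mat xs f) = char_poly (list_mat ys g)"
    using assms(4,5) by (intro char_poly_list_mat_similar[where S = S and T = T]) auto
  with xy show ?thesis by (simp add: char_poly_list_mat)
qed

lemma set_char_poly_cong:
  assumes "finite V" and "\<And>u v. u \<in> V \<Longrightarrow> v \<in> V \<Longrightarrow> f u v = g u v"
  shows "set_char_poly V f = set_char_poly V g"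
proof -
  obtain xs where "distinct xs" "set xs = V"
    using assms(1) finite_distinct_list by meson
  moreover from this assms(2) have "list_mat xs f = list_mat xs g"
    by (auto simp: list_mat_def intro!: cong_mat)
  ultimately show ?thesis by (metis char_poly_list_mat)
qed

lemma set_char_poly_image:
  assumes "finite V" "inj_on h V"
  shows "set_char_poly (h ` V) f = set_char_poly V (\<lambda>u v. f (h u) (h v))"
proof -
  obtain xs where xs: "distinct xs" "set xs = V"
    using assms(1) finite_distinct_list by meson
  have "list_mat (map h xs) f = list_mat xs (\<lambda>u v. f (h u) (h v))"
    by (auto simp: list_mat_def intro!: cong_mat)
  moreover have "distinct (map h xs)"
    using xs assms(2) by (simp add: distinct_map)
  ultimately show ?thesis using xs by (metis char_poly_list_mat set_map)
qed

lemma set_char_poly_Un: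
  assumes "finite V" "finite W" "V \<inter> W = {}"
    and "\<And>u v. u \<in> W \<Longrightarrow> v \<in> V \<Longrightarrow> f u v = 0"
  shows "set_char_poly (V \<union> W) f = set_char_poly V f * set_char_poly W f"
proof -
  obtain xs ys where xy: "distinct xs" "set xs = V" "distinct ys" "set ys = W"
    using assms(1,2) finite_distinct_list by meson
  define A where "A = [:0, 1:] \<cdot>\<^sub>m 1\<^sub>m (length xs) + map_mat (\<lambda>a. [:- a:]) (list_mat xs f)"
  define B where "B = mat (length xs) (length ys) (\<lambda>(i, j). [:- f (xs ! i) (ys ! j):])"
  define D where "D = [:0, 1:] \<cdot>\<^sub>m 1\<^sub>m (length ys) + map_mat (\<lambda>a. [:- a:]) (list_mat ys f)"
  have "char_poly_matrix (list_mat (xs @ ys) f) =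
      four_block_mat A B (0\<^sub>m (length ys) (length xs)) D"
    by (rule eq_matI) (use xy assms(4) in
      \<open>auto simp: char_poly_matrix_def A_def B_def D_def list_mat_def nth_append one_poly_def\<close>)
  moreover have "det (four_block_mat A B (0\<^sub>m (length ys) (length xs)) D) = det A * det D"
    by (rule det_four_block_mat_lower_left_zero) (auto simp: A_def B_def D_def list_mat_def)
  ultimately have "char_poly (list_mat (xs @ ys) f) =
      char_poly (list_mat xs f) * char_poly (list_mat ys f)"
    by (simp add: char_poly_defs A_def D_def list_mat_def)
  moreover have "distinct (xs @ ys)" using xy assms(3) by auto
  ultimately show ?thesis using xy by (metis char_poly_list_mat set_append)
qed

lemma degree_monic_set_char_poly:
  assumes "finite V"
  shows "degree (set_char_poly V f) = card V" "lead_coeff (set_char_poly V f) = 1"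
proof -
  obtain xs where xs: "distinct xs" "set xs = V"
    using assms finite_distinct_list by meson
  have cp: "set_char_poly V f = char_poly (list_mat xs f)" and len: "length xs = card V"
    using xs by (auto simp: char_poly_list_mat distinct_card)
  have "degree (set_char_poly V f) = card V \<and> coeff (set_char_poly V f) (card V) = 1"
    unfolding cp by (rule degree_monic_char_poly) (simp flip: len)
  then show "degree (set_char_poly V f) = card V" "lead_coeff (set_char_poly V f) = 1"
    by auto
qed

lemma set_char_poly_nonzero [simp]: "finite V \<Longrightarrow> set_char_poly V f \<noteq> 0"
  using degree_monic_set_char_poly(2) by (metis leading_coeff_0_iff zero_neq_one)

lemma set_char_poly_root_eigenvector:
  assumes "finite V" "poly (set_char_poly V f) k = 0"
  obtains x where "\<exists>v\<in>V. x v \<noteq> 0" "\<And>u. u \<in> V \<Longrightarrow> (\<Sum>v\<in>V. f u v * x v) = k * x u"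
proof -
  obtain xs where xs: "distinct xs" "set xs = V"
    using assms(1) finite_distinct_list by meson
  let ?n = "length xs"
  have bij: "bij_betw (\<lambda>i. xs ! i) {..<?n} V"
    using xs bij_betw_nth by auto
  have "eigenvalue (list_mat xs f) k"
    using assms(2) xs eigenvalue_root_char_poly[of "list_mat xs f" ?n k]
    by (simp add: char_poly_list_mat)
  then obtain y where y: "y \<in> carrier_vec ?n" "y \<noteq> 0\<^sub>v ?n" "list_mat xs f *\<^sub>v y = k \<cdot>\<^sub>v y"
    by (auto simp: eigenvalue_def eigenvector_def list_mat_def)
  define x where "x v = y $ (the_inv_into {..<?n} (\<lambda>i. xs ! i) v)" for v
  have x: "x (xs ! i) = y $ i" if "i < ?n" for i
    using the_inv_into_f_f[OF bij_betw_imp_inj_on[OF bij]] that by (simp add: x_def)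
  show ?thesis
  proof
    show "\<exists>v\<in>V. x v \<noteq> 0"
    proof (rule ccontr)
      assume "\<not> ?thesis"
      then have "y $ i = 0" if "i < ?n" for i
        using x that xs by (metis nth_mem)
      then have "y = 0\<^sub>v ?n" using y(1) by auto
      with y(2) show False by simp
    qed
    fix u assume "u \<in> V"
    then obtain i where i: "i < ?n" "u = xs ! i" using xs by (metis in_set_conv_nth)
    have "(\<Sum>v\<in>V. f u v * x v) = (\<Sum>j<?n. f (xs ! i) (xs ! j) * y $ j)"
      using sum_distinct_list[OF xs(1), of "\<lambda>v. f u v * x v"] xs(2) i x by simp
    also have "\<dots> = (list_mat xs f *\<^sub>v y) $ i"
      using i y(1) by (simp add: list_mat_def scalar_prod_def atLeast0LessThan)
    also have "\<dots> = k * x u" using i y x by simp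
    finally show "(\<Sum>v\<in>V. f u v * x v) = k * x u" .
  qed
qed

lemma set_char_poly_affine:
  assumes "finite V" "k \<noteq> 0"
  shows "poly (set_char_poly V (\<lambda>u v. (if u = v then a else 0) + k * f u v)) x =
    k ^ card V * poly (set_char_poly V f) ((x - a) / k)"
proof -
  obtain xs where xs: "distinct xs" "set xs = V"
    using assms(1) finite_distinct_list by meson
  let ?n = "length xs" and ?g = "\<lambda>u v. (if u = v then a else 0) + k * f u v"
  have n: "?n = card V" using xs by (metis distinct_card)
  have eval: "poly (char_poly (list_mat xs h)) y = det (mat ?n ?n (\<lambda>(i, j).
      (if i = j then y else 0) - h (xs ! i) (xs ! j)))" for h y
    unfolding char_poly_def
    by (rule poly_det_cong[of _ ?n]) (auto simp: char_poly_matrix_def list_mat_def)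
  have "mat ?n ?n (\<lambda>(i, j). (if i = j then x else 0) - ?g (xs ! i) (xs ! j)) =
      k \<cdot>\<^sub>m mat ?n ?n (\<lambda>(i, j). (if i = j then (x - a) / k else 0) - f (xs ! i) (xs ! j))"
    by (rule eq_matI) (use xs assms(2) in \<open>auto simp: nth_eq_iff_index_eq field_simps\<close>)
  then have "poly (char_poly (list_mat xs ?g)) x =
      k ^ ?n * poly (char_poly (list_mat xs f)) ((x - a) / k)"
    by (simp add: eval det_smult)
  then show ?thesis using xs n by (simp add: char_poly_list_mat)
qed

lemma proots_affine:
  fixes p q :: "'k :: {field, ring_char_0} poly"
  assumes "p \<noteq> 0" "c \<noteq> 0" "k \<noteq> 0" and "\<And>x. poly q x = c * poly p ((x - a) / k)"
  shows "proots q = image_mset (\<lambda>x. a + k * x) (proots p)"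
  using assms(1,2,4)
proof (induction p arbitrary: c q rule: poly_root_order_induct)
  case (no_roots p)
  have "q \<noteq> 0" using no_roots by auto
  then have "set_mset (proots q) = {}" "set_mset (proots p) = {}"
    using no_roots by auto
  then show ?case by simp
next
  case (root p r n)
  define p' where "p' = p \<circ>\<^sub>p [:- a / k, 1 / k:]"
  have p': "poly p' x = 1 * poly p ((x - a) / k)" for x
    by (simp add: p'_def poly_pcompose diff_divide_distrib)
  have "q = Polynomial.smult (c / k ^ n) ([:- (a + k * r), 1:] ^ n * p')"
  proof (rule poly_ext)
    fix x
    have "(x - a) / k - r = (- a - k * r + x) / k"
      using assms(3) by (simp add: field_simps)
    then show "poly q x = poly (Polynomial.smult (c / k ^ n) ([:- (a + k * r), 1:] ^ n * p')) x"
      using assms(3) root.prems p' by (simp add: power_divide)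
  qed
  moreover have "p \<noteq> 0" using root by auto
  moreover from this have "proots p' = image_mset (\<lambda>x. a + k * x) (proots p)"
    using p' by (intro root.IH) auto
  moreover have "p' \<noteq> 0"
    using \<open>p \<noteq> 0\<close> assms(3) unfolding p'_def by (simp add: pcompose_eq_0_iff)
  ultimately show ?case
    using root.prems assms(3) by (simp add: proots_mult proots_power add.commute)
qed simp

lemma proots_set_char_poly_affine:
  fixes f :: "'a \<Rightarrow> 'a \<Rightarrow> 'k :: {field, ring_char_0}"
  assumes "finite V" "k \<noteq> 0"
  shows "proots (set_char_poly V (\<lambda>u v. (if u = v then a else 0) + k * f u v)) =
    image_mset (\<lambda>x. a + k * x) (proots (set_char_poly V f))"
  by (rule proots_affine[OF _ _ _ set_char_poly_affine]) (use assms in auto)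

lemma proots_set_char_poly_scale:
  fixes f :: "'a \<Rightarrow> 'a \<Rightarrow> 'k :: {field, ring_char_0}"
  assumes "finite V" "k \<noteq> 0"
  shows "proots (set_char_poly V (\<lambda>u v. k * f u v)) = image_mset (\<lambda>x. k * x) (proots (set_char_poly V f))"
  using proots_set_char_poly_affine[OF assms, of 0 f] by simp

section \<open>Spectra of real symmetric matrices\<close>

lemma set_char_poly_of_real:
  assumes "finite V"
  shows "set_char_poly V (\<lambda>u v. complex_of_real (f u v)) = map_poly of_real (set_char_poly V f)"
proof -
  obtain xs where xs: "distinct xs" "set xs = V"
    using assms finite_distinct_list by meson
  have "list_mat xs (\<lambda>u v. complex_of_real (f u v)) = map_mat of_real (list_mat xs f)"
    by (rule eq_matI) (simp_all add: list_mat_def)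
  then show ?thesis
    using xs of_real_hom.char_poly_hom[OF list_mat_carrier, of xs f]
    by (metis char_poly_list_mat)
qed

lemma set_char_poly_symmetric_root_real:
  fixes f :: "'a \<Rightarrow> 'a \<Rightarrow> real"
  assumes "finite V" and sym: "\<And>u v. u \<in> V \<Longrightarrow> v \<in> V \<Longrightarrow> f u v = f v u"
    and "poly (set_char_poly V (\<lambda>u v. complex_of_real (f u v))) z = 0"
  shows "z \<in> \<real>"
proof -
  obtain x where x: "\<exists>v\<in>V. x v \<noteq> 0"
    "\<And>u. u \<in> V \<Longrightarrow> (\<Sum>v\<in>V. complex_of_real (f u v) * x v) = z * x u"
    using set_char_poly_root_eigenvector[OF assms(1,3)] by metis
  define N where "N = (\<Sum>u\<in>V. (cmod (x u))\<^sup>2)"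
  define s where "s = (\<Sum>u\<in>V. \<Sum>v\<in>V. cnj (x u) * (of_real (f u v) * x v))"
  have "s = (\<Sum>u\<in>V. z * (x u * cnj (x u)))"
    unfolding s_def by (intro sum.cong refl) (simp add: x(2) flip: sum_distrib_left)
  also have "\<dots> = z * of_real N"
    unfolding N_def of_real_sum sum_distrib_left complex_norm_square ..
  finally have s: "s = z * of_real N" .
  have "cnj s = (\<Sum>u\<in>V. \<Sum>v\<in>V. x u * (of_real (f u v) * cnj (x v)))"
    by (simp add: s_def)
  also have "\<dots> = (\<Sum>v\<in>V. \<Sum>u\<in>V. x u * (of_real (f u v) * cnj (x v)))"
    by (rule sum.swap)
  also have "\<dots> = s"
    unfolding s_def by (intro sum.cong refl) (simp add: sym)
  finally have "cnj z * of_real N = z * of_real N"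
    by (simp add: s)
  moreover have "N > 0"
    using x(1) unfolding N_def by (auto intro: sum_pos2[OF assms(1)])
  ultimately show ?thesis
    by (simp add: complex_is_Real_iff complex_eq_iff)
qed

lemma size_proots_symmetric:
  fixes f :: "'a \<Rightarrow> 'a \<Rightarrow> real"
  assumes "finite V" and "\<And>u v. u \<in> V \<Longrightarrow> v \<in> V \<Longrightarrow> f u v = f v u"
  shows "size (proots (set_char_poly V f)) = card V"
proof -
  let ?p = "set_char_poly V f"
  interpret of_real_poly_hom: map_poly_inj_idom_hom complex_of_real ..
  let ?q = "map_poly complex_of_real ?p"
  obtain as where as: "Polynomial.smult (lead_coeff ?q) (\<Prod>a\<leftarrow>as. [:- a, 1:]) = ?q"
    using fundamental_theorem_algebra_factorized by blast
  have "lead_coeff ?q = 1"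
    using degree_monic_set_char_poly(2)[OF assms(1), of f] by simp
  with as have as: "?q = (\<Prod>a\<leftarrow>as. [:- a, 1:])" by simp
  have "a \<in> \<real>" if "a \<in> set as" for a
  proof (rule set_char_poly_symmetric_root_real[OF assms])
    have "poly ?q a = 0" using that unfolding as by (induction as) auto
    then show "poly (set_char_poly V (\<lambda>u v. complex_of_real (f u v))) a = 0"
      by (simp add: set_char_poly_of_real assms(1))
  qed
  then have "(\<Prod>a\<leftarrow>as. [:- a, 1:]) = map_poly complex_of_real (\<Prod>a\<leftarrow>as. [:- Re a, 1:])"
    by (induction as) (auto simp: of_real_poly_hom.hom_mult simp del: mult_pCons_left)
  with as have p: "?p = (\<Prod>a\<leftarrow>as. [:- Re a, 1:])"
    by simp
  have "proots (\<Prod>a\<leftarrow>as. [:- Re a, 1:]) = mset (map Re as)"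
  proof (induction as)
    case (Cons a as)
    moreover have "(\<Prod>a\<leftarrow>as. [:- Re a, 1:]) \<noteq> 0" by (auto simp: prod_list_zero_iff)
    ultimately show ?case by (simp add: proots_mult del: mult_pCons_left)
  qed simp
  moreover have "length as = degree ?p"
    unfolding p using degree_linear_factors[of "\<lambda>a. - a" "map Re as"] by (simp add: comp_def)
  ultimately show ?thesis
    using degree_monic_set_char_poly(1)[OF assms(1), of f] p by simp
qed

lemma set_char_poly_root_le_row_sum:
  fixes f :: "'a \<Rightarrow> 'a \<Rightarrow> real"
  assumes "finite V" and "\<And>u v. u \<in> V \<Longrightarrow> v \<in> V \<Longrightarrow> f u v \<ge> 0"
    and "\<And>u. u \<in> V \<Longrightarrow> (\<Sum>v\<in>V. f u v) \<le> r"
    and "poly (set_char_poly V f) k = 0"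
  shows "\<bar>k\<bar> \<le> r"
proof -
  obtain x where x: "\<exists>v\<in>V. x v \<noteq> 0" "\<And>u. u \<in> V \<Longrightarrow> (\<Sum>v\<in>V. f u v * x v) = k * x u"
    using set_char_poly_root_eigenvector[OF assms(1,4)] by metis
  then have "V \<noteq> {}" by auto
  then obtain u where u: "u \<in> V" "\<And>v. v \<in> V \<Longrightarrow> \<bar>x v\<bar> \<le> \<bar>x u\<bar>"
    using ex_is_arg_min_if_finite[OF assms(1), of "\<lambda>v. - \<bar>x v\<bar>"]
    by (force simp: is_arg_min_linorder)
  have "\<bar>k\<bar> * \<bar>x u\<bar> = \<bar>\<Sum>v\<in>V. f u v * x v\<bar>"
    using x(2)[OF u(1)] by (simp add: abs_mult)
  also have "\<dots> \<le> (\<Sum>v\<in>V. \<bar>f u v * x v\<bar>)"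
    by (rule sum_abs)
  also have "\<dots> \<le> (\<Sum>v\<in>V. f u v * \<bar>x u\<bar>)"
    using u assms(2) by (intro sum_mono) (auto simp: abs_mult intro!: mult_mono)
  also have "\<dots> \<le> r * \<bar>x u\<bar>"
    using assms(3)[OF u(1)] by (simp add: mult_right_mono flip: sum_distrib_right)
  finally have "\<bar>k\<bar> * \<bar>x u\<bar> \<le> r * \<bar>x u\<bar>" .
  moreover have "\<bar>x u\<bar> > 0" using x(1) u(2) by force
  ultimately show ?thesis by simp
qed

section \<open>Block matrices\<close>

lemma det_2:
  fixes A :: "'k :: comm_ring_1 mat"
  assumes "A \<in> carrier_mat 2 2"
  shows "det A = A $$ (0, 0) * A $$ (1, 1) - A $$ (1, 0) * A $$ (0, 1)"
proof -
  have "mat_delete A i 0 \<in> carrier_mat 1 1" for i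
    using mat_delete_carrier[OF assms, of i 0] by simp
  then have "det (mat_delete A i 0) = mat_delete A i 0 $$ (0, 0)" for i
    by (rule det_single)
  then show ?thesis
    using assms laplace_expansion_column[OF assms, of 0]
    by (simp add: cofactor_def mat_delete_def numeral_2_eq_2)
qed

lemma det_3:
  fixes A :: "'k :: comm_ring_1 mat"
  assumes "A \<in> carrier_mat 3 3"
  shows "det A =
      A $$ (0, 0) * (A $$ (1, 1) * A $$ (2, 2) - A $$ (2, 1) * A $$ (1, 2))
    - A $$ (1, 0) * (A $$ (0, 1) * A $$ (2, 2) - A $$ (2, 1) * A $$ (0, 2))
    + A $$ (2, 0) * (A $$ (0, 1) * A $$ (1, 2) - A $$ (1, 1) * A $$ (0, 2))"
proof -
  have del: "mat_delete A i 0 \<in> carrier_mat 2 2" for i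
    using mat_delete_carrier[OF assms, of i 0] by simp
  have "{..<3 :: nat} = {0, 1, 2}" by auto
  then have "det A = A $$ (0, 0) * det (mat_delete A 0 0) - A $$ (1, 0) * det (mat_delete A 1 0)
      + A $$ (2, 0) * det (mat_delete A 2 0)"
    using laplace_expansion_column[OF assms, of 0] by (simp add: cofactor_def)
  then show ?thesis
    unfolding det_2[OF del] using assms by (simp add: mat_delete_def numeral_2_eq_2)
qed

lemma set_char_poly_3:
  fixes f :: "'a \<Rightarrow> 'a \<Rightarrow> 'k :: field"
  assumes "distinct [x, y, z]"
  shows "poly (set_char_poly {x, y, z} f) t =
      (t - f x x) * ((t - f y y) * (t - f z z) - f z y * f y z)
    + f y x * (- f x y * (t - f z z) - f z y * f x z)
    - f z x * (f x y * f y z + (t - f y y) * f x z)"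
proof -
  let ?A = "list_mat [x, y, z] f"
  have *: "set_char_poly {x, y, z} f = char_poly ?A"
    using char_poly_list_mat[OF assms, of f] by simp
  have carr: "char_poly_matrix ?A \<in> carrier_mat 3 3"
    using list_mat_carrier[of "[x, y, z]" f] by (intro char_poly_matrix_closed) (simp add: eval_nat_numeral)
  show ?thesis
    unfolding * char_poly_def det_3[OF carr]
    by (simp add: char_poly_matrix_def list_mat_def algebra_simps)
qed

text \<open>
  The matrix is the Kronecker product of \<open>h\<close> with the 2-by-2 matrix with rows \<open>(\<alpha>, \<alpha>)\<close> and
  \<open>(\<gamma>, 0)\<close>, whose eigenvectors are \<open>(k\<^sub>1, \<gamma>)\<close> and \<open>(k\<^sub>2, \<gamma>)\<close>.
\<close>

lemma set_char_poly_double: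
  fixes h :: "'a \<Rightarrow> 'a \<Rightarrow> real" and F :: "'a + 'a \<Rightarrow> 'a + 'a \<Rightarrow> real"
  assumes "finite X"
    and F: "\<And>u v. u \<in> X \<Longrightarrow> v \<in> X \<Longrightarrow> F (Inl u) (Inl v) = \<alpha> * h u v"
      "\<And>u v. u \<in> X \<Longrightarrow> v \<in> X \<Longrightarrow> F (Inl u) (Inr v) = \<alpha> * h u v"
      "\<And>u v. u \<in> X \<Longrightarrow> v \<in> X \<Longrightarrow> F (Inr u) (Inl v) = \<gamma> * h u v"
      "\<And>u v. u \<in> X \<Longrightarrow> v \<in> X \<Longrightarrow> F (Inr u) (Inr v) = 0"
    and k: "k\<^sub>1 * k\<^sub>1 = \<alpha> * k\<^sub>1 + \<alpha> * \<gamma>" "k\<^sub>2 * k\<^sub>2 = \<alpha> * k\<^sub>2 + \<alpha> * \<gamma>" "k\<^sub>1 \<noteq> k\<^sub>2" "\<gamma> \<noteq> 0"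
  shows "set_char_poly (X <+> X) F =
    set_char_poly X (\<lambda>u v. k\<^sub>1 * h u v) * set_char_poly X (\<lambda>u v. k\<^sub>2 * h u v)"
proof -
  define G :: "'a + 'a \<Rightarrow> 'a + 'a \<Rightarrow> real" where
    "G x y = (case (x, y) of (Inl u, Inl v) \<Rightarrow> k\<^sub>1 * h u v | (Inr u, Inr v) \<Rightarrow> k\<^sub>2 * h u v | _ \<Rightarrow> 0)" for x y
  define S :: "'a + 'a \<Rightarrow> 'a + 'a \<Rightarrow> real" where
    "S x y = (case (x, y) of
        (Inl u, Inl v) \<Rightarrow> k\<^sub>1 * (if u = v then 1 else 0) | (Inl u, Inr v) \<Rightarrow> k\<^sub>2 * (if u = v then 1 else 0)
      | (Inr u, Inl v) \<Rightarrow> \<gamma> * (if u = v then 1 else 0) | (Inr u, Inr v) \<Rightarrow> \<gamma> * (if u = v then 1 else 0))" for x y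
  obtain t\<^sub>1 t\<^sub>2 t\<^sub>3 t\<^sub>4 where t: "k\<^sub>1 * t\<^sub>1 + \<gamma> * t\<^sub>2 = 1" "k\<^sub>2 * t\<^sub>1 + \<gamma> * t\<^sub>2 = 0"
    "k\<^sub>1 * t\<^sub>3 + \<gamma> * t\<^sub>4 = 0" "k\<^sub>2 * t\<^sub>3 + \<gamma> * t\<^sub>4 = 1"
  proof
    show "k\<^sub>1 * (1 / (k\<^sub>1 - k\<^sub>2)) + \<gamma> * (- k\<^sub>2 / (\<gamma> * (k\<^sub>1 - k\<^sub>2))) = 1"
      "k\<^sub>2 * (1 / (k\<^sub>1 - k\<^sub>2)) + \<gamma> * (- k\<^sub>2 / (\<gamma> * (k\<^sub>1 - k\<^sub>2))) = 0"
      "k\<^sub>1 * (- 1 / (k\<^sub>1 - k\<^sub>2)) + \<gamma> * (k\<^sub>1 / (\<gamma> * (k\<^sub>1 - k\<^sub>2))) = 0"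
      "k\<^sub>2 * (- 1 / (k\<^sub>1 - k\<^sub>2)) + \<gamma> * (k\<^sub>1 / (\<gamma> * (k\<^sub>1 - k\<^sub>2))) = 1"
      using k(3,4) by (simp_all add: divide_simps)
  qed
  define T :: "'a + 'a \<Rightarrow> 'a + 'a \<Rightarrow> real" where
    "T x y = (case (x, y) of
        (Inl u, Inl v) \<Rightarrow> t\<^sub>1 * (if u = v then 1 else 0) | (Inl u, Inr v) \<Rightarrow> t\<^sub>2 * (if u = v then 1 else 0)
      | (Inr u, Inl v) \<Rightarrow> t\<^sub>3 * (if u = v then 1 else 0) | (Inr u, Inr v) \<Rightarrow> t\<^sub>4 * (if u = v then 1 else 0))" for x y
  have delta:
    "(\<Sum>v\<in>X. p v * (c * (if v = w then 1 else 0))) = c * p w"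
    "(\<Sum>v\<in>X. c * (if w = v then 1 else 0) * p v) = c * p w" if "w \<in> X" for p w and c :: real
    using that assms(1) sum_mult_delta(1)[OF assms(1), of "\<lambda>v. p v * c" w]
      sum_mult_delta(4)[OF assms(1), of w "\<lambda>v. c * p v"]
    by (simp_all add: mult_ac)
  have k': "k\<^sub>1 * (k\<^sub>1 * z) = \<alpha> * (k\<^sub>1 * z) + \<alpha> * (\<gamma> * z)"
    "k\<^sub>2 * (k\<^sub>2 * z) = \<alpha> * (k\<^sub>2 * z) + \<alpha> * (\<gamma> * z)" for z
    using k(1,2) by (simp_all add: distrib_right flip: mult.assoc)
  have "set_char_poly (X <+> X) F = set_char_poly (X <+> X) G"
  proof (rule set_char_poly_similar[where S = S and T = T])
    fix x y assume "x \<in> X <+> X" "y \<in> X <+> X"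
    then show "(\<Sum>v\<in>X <+> X. F x v * S v y) = (\<Sum>v\<in>X <+> X. S x v * G v y)"
      by (auto simp: sum.Plus assms(1) F G_def S_def delta) (simp_all add: k' algebra_simps)
    show "(\<Sum>v\<in>X <+> X. T x v * S v y) = (if x = y then 1 else 0)"
      using \<open>x \<in> X <+> X\<close> \<open>y \<in> X <+> X\<close>
      by (auto simp: sum.Plus assms(1) T_def S_def delta t split: if_splits)
  qed (use assms(1) in auto)
  also have "\<dots> = set_char_poly (Inl ` X) G * set_char_poly (Inr ` X) G"
    unfolding Plus_def by (rule set_char_poly_Un) (use assms(1) in \<open>auto simp: G_def\<close>)
  finally show ?thesis
    using assms(1) by (simp add: set_char_poly_image G_def)
qed

text \<open>
  The columns of \<open>basis_mat u0\<close> are the all-ones vector (in position \<open>u0\<close>) and the vectors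
  $e_w - e_{u_0}$, which span the vectors of sum zero. A matrix with all row and column sums equal
  to \<open>r\<close> preserves both subspaces; \<open>split_mat r u0 f\<close> is its matrix in the new basis.
\<close>

definition basis_mat :: "'a \<Rightarrow> 'a \<Rightarrow> 'a \<Rightarrow> real" where
  "basis_mat u0 u w = (if w = u0 then 1 else (if u = w then 1 else 0) - (if u = u0 then 1 else 0))"

definition basis_inv :: "real \<Rightarrow> 'a \<Rightarrow> 'a \<Rightarrow> 'a \<Rightarrow> real" where
  "basis_inv n u0 w u = (if w = u0 then 1 / n else (if w = u then 1 else 0) - 1 / n)"

definition split_mat :: "real \<Rightarrow> 'a \<Rightarrow> ('a \<Rightarrow> 'a \<Rightarrow> real) \<Rightarrow> 'a \<Rightarrow> 'a \<Rightarrow> real" where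
  "split_mat r u0 f u v =
     (if u = u0 then if v = u0 then r else 0 else if v = u0 then 0 else f u v - f u u0)"

lemma basis_mat_same [simp]: "basis_mat u0 u u0 = 1"
  by (simp add: basis_mat_def)

lemma sum_mult_basis_mat:
  assumes "finite V" "u0 \<in> V" "w \<in> V"
  shows "(\<Sum>v\<in>V. h v * basis_mat u0 v w) = (if w = u0 then \<Sum>v\<in>V. h v else h w - h u0)"
  using assms by (simp add: basis_mat_def right_diff_distrib sum_subtractf)

lemma sum_basis_mat:
  assumes "finite V" "u0 \<in> V" "w \<in> V"
  shows "(\<Sum>v\<in>V. basis_mat u0 v w) = (if w = u0 then card V else 0)"
  using sum_mult_basis_mat[OF assms, of "\<lambda>_. 1"] by simp

lemma sum_basis_mat_mult_single:
  assumes "finite V" "u0 \<in> V"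
  shows "(\<Sum>v\<in>V. basis_mat u0 u v * (if v = u0 then c else 0)) = c"
  using assms by (simp add: if_distrib[of "\<lambda>x. _ * x"] cong: if_cong)

lemma sum_basis_mat_mult_split_mat:
  assumes "finite V" "u0 \<in> V" "u \<in> V" "w \<in> V"
    and "\<And>v. v \<in> V \<Longrightarrow> (\<Sum>u\<in>V. f u v) = r"
  shows "(\<Sum>v\<in>V. basis_mat u0 u v * split_mat r u0 f v w) = (if w = u0 then r else f u w - f u u0)"
proof (cases "w = u0")
  case True
  then show ?thesis
    using sum_basis_mat_mult_single[OF assms(1,2), of u r] by (simp add: split_mat_def cong: if_cong)
next
  case False
  define h where "h v = f v w - f v u0" for v
  have "(\<Sum>v\<in>V. h v) = 0"
    using assms by (simp add: h_def sum_subtractf)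
  then have h: "(\<Sum>v\<in>V - {u0}. h v) = - h u0"
    using sum.remove[OF assms(1,2), of h] by simp
  have "(\<Sum>v\<in>V. basis_mat u0 u v * split_mat r u0 f v w) =
      (\<Sum>v\<in>V - {u0}. basis_mat u0 u v * split_mat r u0 f v w)"
    by (subst sum.remove[OF assms(1,2)]) (simp add: False split_mat_def)
  also have "\<dots> = (\<Sum>v\<in>V - {u0}. (if u = v then 1 else 0) * h v - (if u = u0 then 1 else 0) * h v)"
    using False by (intro sum.cong) (auto simp: split_mat_def basis_mat_def h_def)
  also have "\<dots> = (if u \<in> V - {u0} then h u else 0) - (if u = u0 then 1 else 0) * (\<Sum>v\<in>V - {u0}. h v)"
    using assms(1) by (simp add: sum_subtractf)
  also have "\<dots> = h u"
    using h assms(3) by auto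
  finally show ?thesis using False by (simp add: h_def)
qed

lemma basis_inv_mult_basis_mat:
  assumes "finite V" "u0 \<in> V" "u \<in> V" "w \<in> V"
  shows "(\<Sum>v\<in>V. basis_inv (card V) u0 u v * basis_mat u0 v w) = (if u = w then 1 else 0)"
proof -
  have "card V \<noteq> 0" using assms by auto
  moreover have "(\<Sum>v\<in>V. basis_inv (card V) u0 u v) = (if u = u0 then 1 else 0)"
    using assms \<open>card V \<noteq> 0\<close> by (simp add: basis_inv_def sum_subtractf)
  ultimately show ?thesis
    using assms by (auto simp: sum_mult_basis_mat basis_inv_def)
qed

lemma set_char_poly_regular:
  fixes f :: "'a \<Rightarrow> 'a \<Rightarrow> real"
  assumes "finite V" "u0 \<in> V"
    and "\<And>u. u \<in> V \<Longrightarrow> (\<Sum>v\<in>V. f u v) = r" "\<And>v. v \<in> V \<Longrightarrow> (\<Sum>u\<in>V. f u v) = r"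
  shows "set_char_poly V f = [:- r, 1:] * set_char_poly (V - {u0}) (\<lambda>u v. f u v - f u u0)"
proof -
  have "set_char_poly V f = set_char_poly V (split_mat r u0 f)"
    by (rule set_char_poly_similar[where S = "basis_mat u0" and T = "basis_inv (card V) u0"])
      (use assms in \<open>simp_all add: basis_inv_mult_basis_mat,
        simp add: sum_mult_basis_mat sum_basis_mat_mult_split_mat\<close>)
  also have "\<dots> = set_char_poly ({u0} \<union> (V - {u0})) (split_mat r u0 f)"
    using assms(2) by (simp add: insert_absorb)
  also have "\<dots> = set_char_poly {u0} (split_mat r u0 f) * set_char_poly (V - {u0}) (split_mat r u0 f)"
    by (rule set_char_poly_Un) (use assms(1) in \<open>auto simp: split_mat_def\<close>)
  also have "set_char_poly {u0} (split_mat r u0 f) = [:- r, 1:]"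
  proof -
    have "set_char_poly {u0} (split_mat r u0 f) = char_poly (list_mat [u0] (split_mat r u0 f))"
      by (simp add: char_poly_list_mat)
    also have "\<dots> = [:- r, 1:]"
      unfolding char_poly_def
      by (subst det_single) (auto simp: char_poly_matrix_def list_mat_def split_mat_def)
    finally show ?thesis .
  qed
  also have "set_char_poly (V - {u0}) (split_mat r u0 f) = set_char_poly (V - {u0}) (\<lambda>u v. f u v - f u u0)"
    by (rule set_char_poly_cong) (use assms(1) in \<open>auto simp: split_mat_def\<close>)
  finally show ?thesis .
qed

text \<open>
  The shape of $D^{-1}A$ for the NS join, \<open>\<alpha>\<close>, \<open>\<beta>\<close>, \<open>\<gamma>\<close> being the inverse degrees of the vertices
  of the first graph, of the second graph and of the new vertices; it avoids the square roots of
  $D^{-1/2}AD^{-1/2}$.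
\<close>

fun ns_mat :: "real \<Rightarrow> real \<Rightarrow> real \<Rightarrow> ('a \<Rightarrow> 'a \<Rightarrow> real) \<Rightarrow> ('b \<Rightarrow> 'b \<Rightarrow> real)
    \<Rightarrow> ('a + 'b) + 'a \<Rightarrow> ('a + 'b) + 'a \<Rightarrow> real" where
  "ns_mat \<alpha> \<beta> \<gamma> f g (Inl (Inl u)) (Inl (Inl v)) = \<alpha> * f u v"
| "ns_mat \<alpha> \<beta> \<gamma> f g (Inl (Inl u)) (Inl (Inr v)) = \<alpha>"
| "ns_mat \<alpha> \<beta> \<gamma> f g (Inl (Inl u)) (Inr v) = \<alpha> * f u v"
| "ns_mat \<alpha> \<beta> \<gamma> f g (Inl (Inr u)) (Inl (Inl v)) = \<beta>"
| "ns_mat \<alpha> \<beta> \<gamma> f g (Inl (Inr u)) (Inl (Inr v)) = \<beta> * g u v"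
| "ns_mat \<alpha> \<beta> \<gamma> f g (Inl (Inr u)) (Inr v) = 0"
| "ns_mat \<alpha> \<beta> \<gamma> f g (Inr u) (Inl (Inl v)) = \<gamma> * f u v"
| "ns_mat \<alpha> \<beta> \<gamma> f g (Inr u) (Inl (Inr v)) = 0"
| "ns_mat \<alpha> \<beta> \<gamma> f g (Inr u) (Inr v) = 0"

lemma set_char_poly_ns_mat:
  fixes f :: "'a \<Rightarrow> 'a \<Rightarrow> real" and g :: "'b \<Rightarrow> 'b \<Rightarrow> real"
  assumes "finite V" "u0 \<in> V" "finite W" "v0 \<in> W"
    and f: "\<And>u. u \<in> V \<Longrightarrow> (\<Sum>v\<in>V. f u v) = r" "\<And>v. v \<in> V \<Longrightarrow> (\<Sum>u\<in>V. f u v) = r"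
    and g: "\<And>u. u \<in> W \<Longrightarrow> (\<Sum>v\<in>W. g u v) = s" "\<And>v. v \<in> W \<Longrightarrow> (\<Sum>u\<in>W. g u v) = s"
    and k: "k\<^sub>1 * k\<^sub>1 = \<alpha> * k\<^sub>1 + \<alpha> * \<gamma>" "k\<^sub>2 * k\<^sub>2 = \<alpha> * k\<^sub>2 + \<alpha> * \<gamma>" "k\<^sub>1 \<noteq> k\<^sub>2" "\<gamma> \<noteq> 0"
  obtains p where
    "set_char_poly ((V <+> W) <+> V) (ns_mat \<alpha> \<beta> \<gamma> f g) =
       p * (set_char_poly (W - {v0}) (\<lambda>u v. \<beta> * (g u v - g u v0))
         * (set_char_poly (V - {u0}) (\<lambda>u v. k\<^sub>1 * (f u v - f u u0))
          * set_char_poly (V - {u0}) (\<lambda>u v. k\<^sub>2 * (f u v - f u u0))))"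
    "\<And>x. poly p x = (x - \<alpha> * r) * (x - \<beta> * s) * x - \<alpha> * card W * (\<beta> * card V) * x
        - \<alpha> * r * (\<gamma> * r) * (x - \<beta> * s)"
    "p \<noteq> 0"
proof
  let ?\<Omega> = "(V <+> W) <+> V"
  define G :: "('a + 'b) + 'a \<Rightarrow> ('a + 'b) + 'a \<Rightarrow> real" where
    "G x y = (case (x, y) of
        (Inl (Inl u), Inl (Inl v)) \<Rightarrow> split_mat (\<alpha> * r) u0 (\<lambda>u v. \<alpha> * f u v) u v
      | (Inl (Inl u), Inl (Inr v)) \<Rightarrow> (if u = u0 then if v = v0 then \<alpha> * card W else 0 else 0)
      | (Inl (Inl u), Inr v) \<Rightarrow> split_mat (\<alpha> * r) u0 (\<lambda>u v. \<alpha> * f u v) u v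
      | (Inl (Inr u), Inl (Inl v)) \<Rightarrow> (if u = v0 then if v = u0 then \<beta> * card V else 0 else 0)
      | (Inl (Inr u), Inl (Inr v)) \<Rightarrow> split_mat (\<beta> * s) v0 (\<lambda>u v. \<beta> * g u v) u v
      | (Inr u, Inl (Inl v)) \<Rightarrow> split_mat (\<gamma> * r) u0 (\<lambda>u v. \<gamma> * f u v) u v
      | _ \<Rightarrow> 0)" for x y
  define S :: "('a + 'b) + 'a \<Rightarrow> ('a + 'b) + 'a \<Rightarrow> real" where
    "S x y = (case (x, y) of
        (Inl (Inl u), Inl (Inl v)) \<Rightarrow> basis_mat u0 u v
      | (Inl (Inr u), Inl (Inr v)) \<Rightarrow> basis_mat v0 u v
      | (Inr u, Inr v) \<Rightarrow> basis_mat u0 u v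
      | _ \<Rightarrow> 0)" for x y
  define T :: "('a + 'b) + 'a \<Rightarrow> ('a + 'b) + 'a \<Rightarrow> real" where
    "T x y = (case (x, y) of
        (Inl (Inl u), Inl (Inl v)) \<Rightarrow> basis_inv (card V) u0 u v
      | (Inl (Inr u), Inl (Inr v)) \<Rightarrow> basis_inv (card W) v0 u v
      | (Inr u, Inr v) \<Rightarrow> basis_inv (card V) u0 u v
      | _ \<Rightarrow> 0)" for x y
  note sums = sum_mult_basis_mat[OF assms(1,2)] sum_mult_basis_mat[OF assms(3,4)]
    sum_basis_mat[OF assms(1,2)] sum_basis_mat[OF assms(3,4)]
    sum_basis_mat_mult_single[OF assms(1,2)] sum_basis_mat_mult_single[OF assms(3,4)]
    sum_basis_mat_mult_split_mat[OF assms(1,2)] sum_basis_mat_mult_split_mat[OF assms(3,4)]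
    sum_distrib_left[symmetric]
  have eq: "set_char_poly ?\<Omega> (ns_mat \<alpha> \<beta> \<gamma> f g) = set_char_poly ?\<Omega> G"
  proof (rule set_char_poly_similar[where S = S and T = T])
    fix x y assume xy: "x \<in> ?\<Omega>" "y \<in> ?\<Omega>"
    then show "(\<Sum>v\<in>?\<Omega>. ns_mat \<alpha> \<beta> \<gamma> f g x v * S v y) = (\<Sum>v\<in>?\<Omega>. S x v * G v y)"
      by (auto simp: sum.Plus assms(1,3) G_def S_def sums f g)
    show "(\<Sum>v\<in>?\<Omega>. T x v * S v y) = (if x = y then 1 else 0)"
      using xy by (auto simp: sum.Plus assms(1,3) T_def S_def
          basis_inv_mult_basis_mat[OF assms(1,2)] basis_inv_mult_basis_mat[OF assms(3,4)] split: if_splits)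
  qed (use assms(1,3) in auto)
  define X where "X = {Inl (Inl u0), Inl (Inr v0), Inr u0 :: ('a + 'b) + 'a}"
  define h :: "'a + 'a \<Rightarrow> ('a + 'b) + 'a" where
    "h = case_sum (Inl \<circ> Inl) Inr"
  have \<Omega>: "?\<Omega> = X \<union> ((Inl \<circ> Inr) ` (W - {v0}) \<union> h ` ((V - {u0}) <+> (V - {u0})))"
    using assms(2,4) by (auto simp: X_def h_def Plus_def image_Un image_comp)
  show "set_char_poly ?\<Omega> (ns_mat \<alpha> \<beta> \<gamma> f g) =
      set_char_poly X G * (set_char_poly (W - {v0}) (\<lambda>u v. \<beta> * (g u v - g u v0))
         * (set_char_poly (V - {u0}) (\<lambda>u v. k\<^sub>1 * (f u v - f u u0))
          * set_char_poly (V - {u0}) (\<lambda>u v. k\<^sub>2 * (f u v - f u u0))))"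
  proof -
    have "set_char_poly ?\<Omega> G = set_char_poly X G *
        (set_char_poly ((Inl \<circ> Inr) ` (W - {v0})) G * set_char_poly (h ` ((V - {u0}) <+> (V - {u0}))) G)"
      unfolding \<Omega> using assms(1,3)
      by (subst set_char_poly_Un)
        (auto simp: X_def h_def Plus_def G_def split_mat_def split: if_splits intro!: set_char_poly_Un arg_cong2[of _ _ _ _ "(*)"])
    also have "set_char_poly ((Inl \<circ> Inr) ` (W - {v0})) G =
        set_char_poly (W - {v0}) (\<lambda>u v. \<beta> * (g u v - g u v0))"
      using assms(3) by (subst set_char_poly_image)
        (auto simp: G_def split_mat_def inj_on_def algebra_simps split: if_splits intro!: set_char_poly_cong)
    also have "set_char_poly (h ` ((V - {u0}) <+> (V - {u0}))) G =
        set_char_poly ((V - {u0}) <+> (V - {u0})) (\<lambda>x y. G (h x) (h y))"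
      using assms(1) by (intro set_char_poly_image) (auto simp: inj_on_def h_def)
    also have "\<dots> = set_char_poly (V - {u0}) (\<lambda>u v. k\<^sub>1 * (f u v - f u u0))
        * set_char_poly (V - {u0}) (\<lambda>u v. k\<^sub>2 * (f u v - f u u0))"
      by (rule set_char_poly_double[OF _ _ _ _ _ k])
        (use assms(1) in \<open>auto simp: G_def h_def split_mat_def algebra_simps\<close>)
    finally show ?thesis using eq by simp
  qed
  show "poly (set_char_poly X G) x = (x - \<alpha> * r) * (x - \<beta> * s) * x - \<alpha> * card W * (\<beta> * card V) * x
        - \<alpha> * r * (\<gamma> * r) * (x - \<beta> * s)" for x
    unfolding X_def by (subst set_char_poly_3) (auto simp: G_def split_mat_def algebra_simps)
  show "set_char_poly X G \<noteq> 0"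
    by (simp add: X_def)
qed

section \<open>Regular graphs\<close>

definition adj :: "'a pair_pre_digraph \<Rightarrow> 'a \<Rightarrow> 'a \<Rightarrow> real" where
  "adj G u v = (if (u, v) \<in> parcs G then 1 else 0)"

definition nl_entry :: "'a pair_pre_digraph \<Rightarrow> 'a \<Rightarrow> 'a \<Rightarrow> real" where
  "nl_entry G u v =
     (if u = v \<and> vdeg G u \<noteq> 0 then 1
      else if u \<noteq> v \<and> (u, v) \<in> parcs G then - 1 / sqrt (real (vdeg G u) * real (vdeg G v))
      else 0)"

lemma normalized_laplacian_spectrum_conv:
  assumes "finite (pverts G)"
  shows "normalized_laplacian_spectrum G = proots (set_char_poly (pverts G) (nl_entry G))"
proof -
  define vs where "vs = vertex_list G"
  have vs: "distinct vs \<and> set vs = pverts G"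
    unfolding vs_def vertex_list_def
    by (rule someI_ex) (use finite_distinct_list[OF assms] in blast)
  then have "length vs = card (pverts G)" by (metis distinct_card)
  then have "normalized_laplacian G = list_mat vs (nl_entry G)"
    using vs unfolding normalized_laplacian_def list_mat_def Let_def vs_def[symmetric]
    by (auto simp: nl_entry_def nth_eq_iff_index_eq intro!: cong_mat)
  with vs show ?thesis
    by (simp add: normalized_laplacian_spectrum_def char_poly_list_mat)
qed

lemma vdeg_conv_card: "vdeg G v = card {w. (v, w) \<in> parcs G}"
proof -
  have "out_arcs (with_proj G) v = Pair v ` {w. (v, w) \<in> parcs G}"
    by (auto simp: out_arcs_def)
  then show ?thesis
    by (simp add: vdeg_def out_degree_def card_image inj_on_def)
qed

lemma sum_adj_subset:
  assumes "finite V" "\<And>w. (v, w) \<in> parcs G \<Longrightarrow> w \<in> V"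
  shows "(\<Sum>w\<in>V. adj G v w) = vdeg G v"
proof -
  have "V \<inter> {w. (v, w) \<in> parcs G} = {w. (v, w) \<in> parcs G}"
    using assms(2) by auto
  then show ?thesis
    by (simp add: adj_def vdeg_conv_card sum.If_cases assms(1))
qed

context
  fixes G :: "'a pair_pre_digraph"
  assumes G: "pair_graph G"
begin

interpretation pair_graph G by (rule G)

lemma finite_pverts: "finite (pverts G)"
  by (rule pair_finite_verts)

lemma adj_sym: "adj G u v = adj G v u"
  using arcs_symmetric by (auto simp: adj_def)

lemma adj_same: "adj G u u = 0"
  using no_loops' by (auto simp: adj_def)

lemma sum_adj: "(\<Sum>w\<in>pverts G. adj G v w) = vdeg G v"
  by (rule sum_adj_subset) (use finite_pverts in_arcsD2 in auto)

lemma sum_adj': "(\<Sum>u\<in>pverts G. adj G u v) = vdeg G v"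
  using sum_adj[of v] adj_sym by simp

end

lemma image_mset_nth_mset_set:
  "image_mset (\<lambda>i. xs ! i) (mset_set {..<length xs}) = mset xs"
  by (metis map_nth mset_map mset_upt atLeast0LessThan)

lemma image_mset_eq_replicate:
  assumes "\<And>x. x \<in># M \<Longrightarrow> f x = c"
  shows "image_mset f M = replicate_mset (size M) c"
  using assms by (induction M) auto

lemma regular_graph_nl_eigenvalues:
  assumes reg: "regular_graph r G" and "u0 \<in> pverts G"
  shows "image_mset (\<lambda>i. r * (1 - nl_eigenvalue G i)) (mset_set {2..card (pverts G)}) =
    proots (set_char_poly (pverts G - {u0}) (\<lambda>u v. adj G u v - adj G u u0))"
proof -
  let ?V = "pverts G"
  let ?W = "?V - {u0}" and ?h = "\<lambda>u v. adj G u v - adj G u u0"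
  have G: "pair_graph G" and deg: "\<And>v. v \<in> ?V \<Longrightarrow> vdeg G v = r"
    using reg by (auto simp: regular_graph_def)
  note fin = finite_pverts[OF G]
  have spec: "normalized_laplacian_spectrum G = proots (set_char_poly ?V (nl_entry G))"
    by (rule normalized_laplacian_spectrum_conv[OF fin])
  have cp: "set_char_poly ?V (adj G) = [:- real r, 1:] * set_char_poly ?W ?h"
    by (rule set_char_poly_regular) (use fin assms(2) deg in \<open>auto simp: sum_adj[OF G] sum_adj'[OF G]\<close>)
  have proots_cp: "proots (set_char_poly ?V (adj G)) = add_mset (real r) (proots (set_char_poly ?W ?h))"
    unfolding cp using fin by (subst proots_mult) (auto simp del: mult_pCons_left)
  have bound: "\<bar>k\<bar> \<le> real r" if "k \<in># proots (set_char_poly ?V (adj G))" for k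
    by (rule set_char_poly_root_le_row_sum[of ?V "adj G"])
      (use that fin deg in \<open>auto simp: sum_adj[OF G], auto simp: adj_def\<close>)
  have "size (proots (set_char_poly ?V (adj G))) = card ?V"
    by (rule size_proots_symmetric) (use fin adj_sym[OF G] in auto)
  then have size: "Suc (size (proots (set_char_poly ?W ?h))) = card ?V"
    unfolding proots_cp by simp
  show ?thesis
  proof (cases "r = 0")
    case True
    have "image_mset (\<lambda>x. x) (proots (set_char_poly ?W ?h)) =
        replicate_mset (size (proots (set_char_poly ?W ?h))) 0"
      by (rule image_mset_eq_replicate) (use bound True proots_cp in auto)
    then have "proots (set_char_poly ?W ?h) = replicate_mset (card ?V - 1) 0"
      using size by (simp flip: size)
    moreover have "image_mset (\<lambda>i. r * (1 - nl_eigenvalue G i)) (mset_set {2..card ?V}) =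
        replicate_mset (size (mset_set {2..card ?V})) 0"
      by (rule image_mset_eq_replicate) (simp add: True)
    ultimately show ?thesis by simp
  next
    case False
    define M where "M = image_mset (\<lambda>x. 1 - x / r) (proots (set_char_poly ?W ?h))"
    define xs where "xs = sorted_list_of_multiset M"
    have eq: "set_char_poly ?V (nl_entry G) =
        set_char_poly ?V (\<lambda>u v. (if u = v then 1 else 0) + (- 1 / r) * adj G u v)"
      by (rule set_char_poly_cong)
        (use fin deg False adj_same[OF G] in \<open>auto simp: nl_entry_def adj_def split: if_splits\<close>)
    have "normalized_laplacian_spectrum G =
        image_mset (\<lambda>x. 1 + (- 1 / r) * x) (proots (set_char_poly ?V (adj G)))"
      unfolding spec eq
      by (rule proots_set_char_poly_affine) (use fin False in auto)
    also have "\<dots> = add_mset 0 M"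
      unfolding proots_cp M_def using False by simp
    finally have "sorted_list_of_multiset (normalized_laplacian_spectrum G) = insort 0 xs"
      by (simp add: xs_def)
    also have "\<dots> = 0 # xs"
    proof (rule insort_is_Cons)
      show "\<forall>x\<in>set xs. 0 \<le> x"
        using bound False proots_cp by (auto simp: xs_def M_def field_simps abs_le_iff)
    qed
    finally have nl: "nl_eigenvalue G i = (0 # xs) ! (i - 1)" for i
      by (simp add: nl_eigenvalue_def)
    have len: "length xs = card ?V - 1"
      using size by (simp add: xs_def M_def flip: size_mset)
    have "{2..card ?V} = (\<lambda>i. i + 2) ` {..<length xs}"
    proof (intro equalityI subsetI)
      fix i assume "i \<in> {2..card ?V}"
      then have "i = (i - 2) + 2" "i - 2 \<in> {..<length xs}" unfolding len by auto
      then show "i \<in> (\<lambda>i. i + 2) ` {..<length xs}" by (rule image_eqI)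
    qed (auto simp: len)
    then have "mset_set {2..card ?V} = image_mset (\<lambda>i. i + 2) (mset_set {..<length xs})"
      by (simp add: image_mset_mset_set inj_on_def)
    then have "image_mset (\<lambda>i. r * (1 - nl_eigenvalue G i)) (mset_set {2..card ?V}) =
        image_mset (\<lambda>x. r * (1 - x)) (image_mset (\<lambda>i. xs ! i) (mset_set {..<length xs}))"
      by (simp add: nl comp_def multiset.map_comp)
    also have "\<dots> = image_mset (\<lambda>x. r * (1 - x)) M"
      by (simp add: image_mset_nth_mset_set xs_def)
    also have "\<dots> = proots (set_char_poly ?W ?h)"
      using False by (simp add: M_def multiset.map_comp comp_def)
    finally show ?thesis .
  qed
qed

section \<open>The NS join\<close>

lemma set_char_poly_diag:
  assumes "finite V" "\<And>u. u \<in> V \<Longrightarrow> d u \<noteq> 0"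
    and "\<And>u v. u \<in> V \<Longrightarrow> v \<in> V \<Longrightarrow> f u v * d v = d u * g u v"
  shows "set_char_poly V f = set_char_poly V g"
proof (rule set_char_poly_similar[where S = "\<lambda>u v. d v * (if u = v then 1 else 0)"
      and T = "\<lambda>u v. 1 / d u * (if u = v then 1 else 0)"])
  fix u w assume uw: "u \<in> V" "w \<in> V"
  have "(\<Sum>v\<in>V. f u v * (d w * (if v = w then 1 else 0))) = f u w * d w"
    using sum_mult_delta(1)[OF assms(1), of "\<lambda>v. f u v * d w" w] uw by (simp add: mult.assoc)
  moreover have "(\<Sum>v\<in>V. d v * (if u = v then 1 else 0) * g v w) = d u * g u w"
    using sum_mult_delta(4)[OF assms(1), of u "\<lambda>v. d v * g v w"] uw by (simp add: mult_ac)
  ultimately show "(\<Sum>v\<in>V. f u v * (d w * (if v = w then 1 else 0))) =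
      (\<Sum>v\<in>V. d v * (if u = v then 1 else 0) * g v w)"
    using assms(3) uw by simp
  have "(\<Sum>v\<in>V. 1 / d u * (if u = v then 1 else 0) * (d w * (if v = w then 1 else 0))) =
      1 / d u * (if u = w then 1 else 0) * d w"
    using sum_mult_delta(1)[OF assms(1), of "\<lambda>v. 1 / d u * (if u = v then 1 else 0) * d w" w] uw
    by (simp add: mult.assoc)
  then show "(\<Sum>v\<in>V. 1 / d u * (if u = v then 1 else 0) * (d w * (if v = w then 1 else 0))) =
      (if u = w then 1 else 0)"
    using assms(2)[OF uw(2)] by simp
qed (use assms(1) in auto)

lemma pverts_ns_join: "pverts (ns_join G1 G2) = (pverts G1 <+> pverts G2) <+> pverts G1"
  by (simp add: ns_join_def graph_join_def Plus_def)

lemma adj_ns_join [simp]: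
  "adj (ns_join G1 G2) (Inl (Inl u)) (Inl (Inl v)) = adj G1 u v"
  "adj (ns_join G1 G2) (Inl (Inl u)) (Inl (Inr w)) = (if u \<in> pverts G1 \<and> w \<in> pverts G2 then 1 else 0)"
  "adj (ns_join G1 G2) (Inl (Inl u)) (Inr v) = adj G1 v u"
  "adj (ns_join G1 G2) (Inl (Inr w)) (Inl (Inl u)) = (if u \<in> pverts G1 \<and> w \<in> pverts G2 then 1 else 0)"
  "adj (ns_join G1 G2) (Inl (Inr w)) (Inl (Inr x)) = adj G2 w x"
  "adj (ns_join G1 G2) (Inl (Inr w)) (Inr u) = 0"
  "adj (ns_join G1 G2) (Inr u) (Inl (Inl v)) = adj G1 u v"
  "adj (ns_join G1 G2) (Inr u) (Inl (Inr w)) = 0"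
  "adj (ns_join G1 G2) (Inr u) (Inr v) = 0"
  by (auto simp: adj_def ns_join_def graph_join_def)

theorem theorem5p1:
  fixes G1 :: "'a pair_pre_digraph" and G2 :: "'b pair_pre_digraph"
    and r1 r2 n1 n2 :: nat
  assumes "regular_graph r1 G1" and "regular_graph r2 G2"
    and "n1 = card (pverts G1)" and "n2 = card (pverts G2)"
    and "n1 \<ge> 1" and "n2 \<ge> 1"
    and "r1 \<ge> 1"
  shows "normalized_laplacian_spectrum (ns_join G1 G2) =
      {# 1 + real r2 * (nl_eigenvalue G2 i - 1) / (real n1 + real r2). i \<in># mset_set {2..n2} #}
    + {# 1 + (nl_eigenvalue G1 i - 1) * (sqrt (9 * real r1 ^ 2 + 4 * real r1 * real n2) + real r1)
             / (2 * (2 * real r1 + real n2)). i \<in># mset_set {2..n1} #}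
    + {# 1 + (1 - nl_eigenvalue G1 i) * (sqrt (9 * real r1 ^ 2 + 4 * real r1 * real n2) - real r1)
             / (2 * (2 * real r1 + real n2)). i \<in># mset_set {2..n1} #}
    + proots [: 0,
                3 * real r1 * real n1 + real n2 * real r2 + 2 * real n1 * real n2,
                - (3 * real r1 * real r2 + 5 * real r1 * real n1 + 2 * real r2 * real n2
                   + 3 * real n1 * real n2),
                2 * real r1 * real r2 + 2 * real r1 * real n1 + real n2 * real r2
                   + real n1 * real n2 :]"
proof -
  let ?V = "pverts G1" and ?W = "pverts G2" and ?N = "ns_join G1 G2"
  have G1: "pair_graph G1" and deg1: "\<And>v. v \<in> ?V \<Longrightarrow> vdeg G1 v = r1"
    and G2: "pair_graph G2" and deg2: "\<And>v. v \<in> ?W \<Longrightarrow> vdeg G2 v = r2"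
    using assms(1,2) by (auto simp: regular_graph_def)
  note fin1 = finite_pverts[OF G1] and fin2 = finite_pverts[OF G2]
  note sums = sum_adj[OF G1] sum_adj'[OF G1] sum_adj[OF G2] sum_adj'[OF G2]
  obtain u0 v0 where u0: "u0 \<in> ?V" and v0: "v0 \<in> ?W"
    using assms(3-6) by fastforce
  let ?\<Omega> = "(?V <+> ?W) <+> ?V"
  have fin: "finite ?\<Omega>" using fin1 fin2 by simp
  define a b c where "a = 2 * real r1 + n2" and "b = real n1 + r2" and "c = real r1"
  have pos: "a > 0" "b > 0" "c > 0" using assms(5,7) by (auto simp: a_def b_def c_def)
  have arcs: "w \<in> ?\<Omega>" if "(x, w) \<in> parcs ?N" for x w
    using that pair_wf_digraph.wellformed'[OF pair_graph.axioms(1)[THEN pair_digraph.axioms(1), THEN pair_fin_digraph.axioms(1), OF G1]]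
      pair_wf_digraph.wellformed'[OF pair_graph.axioms(1)[THEN pair_digraph.axioms(1), THEN pair_fin_digraph.axioms(1), OF G2]]
    by (auto simp: ns_join_def graph_join_def)
  define d where "d x = real (vdeg ?N x)" for x
  have d_sum: "d x = (\<Sum>w\<in>?\<Omega>. adj ?N x w)" for x
    unfolding d_def by (rule sum_adj_subset[symmetric]) (use fin arcs in auto)
  have d: "u \<in> ?V \<Longrightarrow> d (Inl (Inl u)) = a" "w \<in> ?W \<Longrightarrow> d (Inl (Inr w)) = b"
    "u \<in> ?V \<Longrightarrow> d (Inr u) = c" for u w
    using fin1 fin2
    by (simp_all add: d_sum sum.Plus sums deg1 deg2 a_def b_def c_def assms(3,4))
  have d_pos: "d x > 0" if "x \<in> ?\<Omega>" for x
    using that pos by (auto simp: d)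
  let ?M = "ns_mat (1 / a) (1 / b) (1 / c) (adj G1) (adj G2)"
  have M: "?M x y = adj ?N x y / d x" if "x \<in> ?\<Omega>" "y \<in> ?\<Omega>" for x y
    using that by (auto simp: d adj_sym[OF G1])
  have M_same: "?M x x = 0" if "x \<in> ?\<Omega>" for x
    using that by (auto simp: adj_same[OF G1] adj_same[OF G2])
  have "set_char_poly ?\<Omega> (nl_entry ?N) =
      set_char_poly ?\<Omega> (\<lambda>x y. (if x = y then 1 else 0) + (- 1) * ?M x y)"
  proof (rule set_char_poly_diag[where d = "\<lambda>x. sqrt (d x)"])
    fix x y assume xy: "x \<in> ?\<Omega>" "y \<in> ?\<Omega>"
    show "nl_entry ?N x y * sqrt (d y) = sqrt (d x) * ((if x = y then 1 else 0) + (- 1) * ?M x y)"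
    proof (cases "x = y")
      case True
      then show ?thesis
        using d_pos[OF xy(1)] M_same[OF xy(1)] by (simp add: nl_entry_def d_def)
    next
      case False
      define s where "s = sqrt (d x)"
      have "nl_entry ?N x y = - adj ?N x y / (s * sqrt (d y))"
        using False by (simp add: nl_entry_def adj_def d_def s_def real_sqrt_mult)
      moreover have "d x = s * s" "s \<noteq> 0" "sqrt (d y) \<noteq> 0"
        using d_pos[OF xy(1)] d_pos[OF xy(2)] by (simp_all add: s_def)
      ultimately show ?thesis
        unfolding s_def[symmetric] using False M[OF xy] by simp
    qed
  qed (use fin d_pos in \<open>auto simp: order_less_imp_not_eq2\<close>)
  then have spec: "normalized_laplacian_spectrum ?N =
      image_mset (\<lambda>x. 1 + (- 1) * x) (proots (set_char_poly ?\<Omega> ?M))"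
    using fin normalized_laplacian_spectrum_conv[of ?N]
      proots_set_char_poly_affine[of ?\<Omega> "- 1" 1 ?M]
    by (simp add: pverts_ns_join)
  define q where "q = sqrt (9 * real r1 ^ 2 + 4 * real r1 * real n2)"
  define k\<^sub>1 k\<^sub>2 where "k\<^sub>1 = (c + q) / (2 * a * c)" and "k\<^sub>2 = (c - q) / (2 * a * c)"
  have q2: "q * q = c * c + 4 * a * c"
    by (simp add: q_def a_def c_def algebra_simps power2_eq_square)
  have q: "q > 0"
    using assms(7) by (simp add: q_def add_pos_nonneg)
  have quad: "(c + z) / (2 * a * c) * ((c + z) / (2 * a * c)) =
      1 / a * ((c + z) / (2 * a * c)) + 1 / a * (1 / c)" if "z * z = c * c + 4 * a * c" for z
  proof -
    have "(c + z) * (c + z) = 2 * c * (c + z) + 4 * a * c"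
      using that by (simp add: algebra_simps)
    then have "(c + z) / (2 * a * c) * ((c + z) / (2 * a * c)) =
        (2 * c * (c + z) + 4 * a * c) / ((2 * a * c) * (2 * a * c))"
      by (simp only: times_divide_times_eq)
    also have "\<dots> = 1 / a * ((c + z) / (2 * a * c)) + 1 / a * (1 / c)"
      using pos by (simp add: field_simps)
    finally show ?thesis .
  qed
  have k: "k\<^sub>1 * k\<^sub>1 = 1 / a * k\<^sub>1 + 1 / a * (1 / c)" "k\<^sub>2 * k\<^sub>2 = 1 / a * k\<^sub>2 + 1 / a * (1 / c)"
    "k\<^sub>1 \<noteq> k\<^sub>2" "1 / c \<noteq> 0"
    using quad[of q] quad[of "- q"] q q2 pos by (simp_all add: k\<^sub>1_def k\<^sub>2_def)
  then have k0: "k\<^sub>1 \<noteq> 0" "k\<^sub>2 \<noteq> 0"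
    using pos by auto
  obtain p where p: "set_char_poly ?\<Omega> ?M =
       p * (set_char_poly (?W - {v0}) (\<lambda>u v. 1 / b * (adj G2 u v - adj G2 u v0))
         * (set_char_poly (?V - {u0}) (\<lambda>u v. k\<^sub>1 * (adj G1 u v - adj G1 u u0))
          * set_char_poly (?V - {u0}) (\<lambda>u v. k\<^sub>2 * (adj G1 u v - adj G1 u u0))))"
    "\<And>x. poly p x = (x - 1 / a * r1) * (x - 1 / b * r2) * x - 1 / a * card ?W * (1 / b * card ?V) * x
        - 1 / a * r1 * (1 / c * r1) * (x - 1 / b * r2)"
    "p \<noteq> 0"
    by (rule set_char_poly_ns_mat[OF fin1 u0 fin2 v0 _ _ _ _ k, of "adj G1" r1 "adj G2" r2 "1 / b"])
      (auto simp: sums deg1 deg2)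
  have cubic: "image_mset (\<lambda>x. 1 + (- 1) * x) (proots p) = proots [: 0,
                3 * real r1 * real n1 + real n2 * real r2 + 2 * real n1 * real n2,
                - (3 * real r1 * real r2 + 5 * real r1 * real n1 + 2 * real r2 * real n2
                   + 3 * real n1 * real n2),
                2 * real r1 * real r2 + 2 * real r1 * real n1 + real n2 * real r2
                   + real n1 * real n2 :]" (is "_ = proots ?c")
  proof (rule proots_affine[symmetric, where c = "- (a * b)"])
    fix x
    have "b * (1 / b) = 1" "a * (1 / a) = 1" "1 / c * r1 = 1"
      using pos by (auto simp: c_def)
    moreover have "a * b * poly p y = (a * y - a * (1 / a) * r1) * (b * y - b * (1 / b) * r2) * y
        - a * (1 / a) * (b * (1 / b)) * real n1 * real n2 * y
        - a * (1 / a) * r1 * (1 / c * r1) * (b * y - b * (1 / b) * r2)" for y :: real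
      unfolding p(2) assms(3,4) by (simp only: ring_distribs mult_ac)
    ultimately have "a * b * poly p y = (a * y - r1) * (b * y - r2) * y - real n1 * real n2 * y - r1 * (b * y - r2)"
      for y :: real
      by (simp only: mult_1_left mult_1_right)
    from this[of "1 - x"] show "poly ?c x = - (a * b) * poly p ((x - 1) / - 1)"
      by (simp add: a_def b_def algebra_simps)
  qed (use p(3) pos in auto)
  have nonzero: "set_char_poly (?W - {v0}) h \<noteq> 0" "set_char_poly (?V - {u0}) h' \<noteq> 0" for h h' :: "_ \<Rightarrow> _ \<Rightarrow> real"
    using fin1 fin2 by auto
  have b': "1 / b \<noteq> 0" using pos by simp
  have main: "normalized_laplacian_spectrum ?N = image_mset (\<lambda>x. 1 + (- 1) * x) (proots p)
    + (image_mset (\<lambda>x. 1 + (- 1) * (1 / b * x)) (proots (set_char_poly (?W - {v0}) (\<lambda>u v. adj G2 u v - adj G2 u v0)))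
    + (image_mset (\<lambda>x. 1 + (- 1) * (k\<^sub>1 * x)) (proots (set_char_poly (?V - {u0}) (\<lambda>u v. adj G1 u v - adj G1 u u0)))
    + image_mset (\<lambda>x. 1 + (- 1) * (k\<^sub>2 * x)) (proots (set_char_poly (?V - {u0}) (\<lambda>u v. adj G1 u v - adj G1 u u0)))))"
    unfolding spec p(1) using p(3) nonzero fin1 fin2 k0 b'
    by (simp only: proots_mult mult_eq_0_iff simp_thms if_False
          proots_set_char_poly_scale[where k = k\<^sub>1] proots_set_char_poly_scale[where k = k\<^sub>2]
          proots_set_char_poly_scale[where k = "1 / b"] image_mset_union multiset.map_comp comp_def
          finite_Diff)
  have a_eq: "2 * c + real n2 = a" by (simp add: a_def c_def)
  have e1: "1 + (- 1) * (1 / b * (real r2 * (1 - x))) = 1 + real r2 * (x - 1) / (real n1 + real r2)" for x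
    unfolding b_def[symmetric] using pos by (simp add: field_simps)
  have e2: "1 + (- 1) * (k\<^sub>1 * (real r1 * (1 - x))) =
      1 + (x - 1) * (q + real r1) / (2 * (2 * real r1 + real n2))" for x
    unfolding k\<^sub>1_def c_def[symmetric] a_eq using pos by (simp add: field_simps)
  have e3: "1 + (- 1) * (k\<^sub>2 * (real r1 * (1 - x))) =
      1 + (1 - x) * (q - real r1) / (2 * (2 * real r1 + real n2))" for x
    unfolding k\<^sub>2_def c_def[symmetric] a_eq using pos by (simp add: field_simps)
  show ?thesis
    unfolding main cubic q_def[symmetric] regular_graph_nl_eigenvalues[OF assms(1) u0, symmetric]
      regular_graph_nl_eigenvalues[OF assms(2) v0, symmetric]
      multiset.map_comp comp_def assms(3,4)[symmetric] e1 e2 e3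
    by (simp only: ac_simps)
qed

end
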